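(* Let $m$ and $g\ge 3$ be integers, and let $\mathcal{G}(m,g)$ be the set of simple graphs without isolated vertices that have exactly $m$ edges and girth $g$. Let $G_{m,g}$ be the graph obtained from a cycle $C_g$ by joining one fixed vertex of the cycle to each of $m-g$ new vertices (so $G_{m,g}$ is $C_g$ with $m-g$ pendent edges attached at a single vertex of the cycle). Then $q(G)\le q(G_{m,g})$ for every $G\in\mathcal{G}(m,g)$, with equality if and only if $G\cong G_{m,g}$.
   Context: All graphs are finite, simple, undirected and without isolated vertices. For a graph $G$, $A(G)$ is its adjacency matrix, $D(G)$ the diagonal matrix of vertex degrees, and $Q(G)=A(G)+D(G)$ its signless Laplacian matrix; $q(G)$ denotes the signless Laplacian spectral radius, i.e. the largest eigenvalue of $Q(G)$. The girth of a graph is the minimum length of a cycle in it. *)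

theory Defs
  imports
    "Graph_Theory.Graph_Theory"
    "Jordan_Normal_Form.Spectral_Radius"
    "HOL-Library.Extended_Nat"
begin

(* A finite simple undirected graph is a pair_graph: a finite, loop-free, symmetric
   relation on a finite vertex set. Every undirected edge {u,v} is the pair of arcs (u,v), (v,u),
   so the out-degree of a vertex is its degree. *)

definition edges :: "'a pair_pre_digraph \<Rightarrow> 'a set set" where
  "edges G = {{u, v} | u v. (u, v) \<in> parcs G}"

definition no_isolated :: "'a pair_pre_digraph \<Rightarrow> bool" where
  "no_isolated G \<longleftrightarrow> (\<forall>v \<in> pverts G. out_degree G v \<noteq> 0)"

(* The closed walks u, v, u along a single edge are cycles in the sense of
   pre_digraph.cycle, hence the bound on the length. The girth of a forest is infinity. *)
definition girth :: "'a pair_pre_digraph \<Rightarrow> enat" where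
  "girth G = (INF p \<in> {p. pre_digraph.cycle G p \<and> 3 \<le> length p}. enat (length p))"

(* The enumeration only fixes the order of the rows and columns of the matrices below. *)
definition vertex_list :: "'a pair_pre_digraph \<Rightarrow> 'a list" where
  "vertex_list G = (SOME vs. distinct vs \<and> set vs = pverts G)"

definition adjacency_mat :: "'a pair_pre_digraph \<Rightarrow> real mat" where
  "adjacency_mat G = mat (card (pverts G)) (card (pverts G))
     (\<lambda>(i, j). if (vertex_list G ! i, vertex_list G ! j) \<in> parcs G then 1 else 0)"

definition degree_mat :: "'a pair_pre_digraph \<Rightarrow> real mat" where
  "degree_mat G = mat (card (pverts G)) (card (pverts G))
     (\<lambda>(i, j). if i = j then real (out_degree G (vertex_list G ! i)) else 0)"

definition signless_laplacian :: "'a pair_pre_digraph \<Rightarrow> real mat" where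
  "signless_laplacian G = adjacency_mat G + degree_mat G"

definition signless_radius :: "'a pair_pre_digraph \<Rightarrow> real" where
  "signless_radius G = Max (spectrum (signless_laplacian G))"

definition graphs_size_girth :: "nat \<Rightarrow> nat \<Rightarrow> 'a pair_pre_digraph set" where
  "graphs_size_girth m g =
     {G. pair_graph G \<and> no_isolated G \<and> card (edges G) = m \<and> girth G = enat g}"

definition cycle_graph :: "nat \<Rightarrow> nat pair_pre_digraph" where
  "cycle_graph g = \<lparr> pverts = {..<g},
     parcs = {(i, j). i < g \<and> j < g \<and> (j = Suc i mod g \<or> i = Suc j mod g)} \<rparr>"

definition pendant_cycle :: "nat \<Rightarrow> nat \<Rightarrow> nat pair_pre_digraph" where
  "pendant_cycle m g = \<lparr> pverts = pverts (cycle_graph g) \<union> {g..<m},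
     parcs = parcs (cycle_graph g) \<union> {0} \<times> {g..<m} \<union> {g..<m} \<times> {0} \<rparr>"

end

theory Submission
  imports Defs
begin

text \<open>
  Let \<open>d(v)\<close> be the degree of \<open>v\<close>. A vertex of degree at least \<open>m - g + 2\<close> must lie on a
  shortest cycle, and then counting edges forces \<open>G\<close> to be the pendant cycle. So suppose that all
  degrees are at most \<open>D = m - g + 1\<close>. With the positive test vector \<open>d\<close>, every eigenvalue is at
  most the maximum over \<open>v\<close> of \<open>d(v) + S(v) / d(v)\<close>, where \<open>S(v)\<close> is the sum of the degrees of
  the neighbours of \<open>v\<close>. If \<open>d(v) \<le> 2\<close>, this is at most \<open>D + 2\<close>, because \<open>S(v) \<le> D d(v)\<close>.
  Otherwise one uses \<open>S(v) \<le> m - g + 4\<close> if \<open>g \<ge> 4\<close> (no triangles, and at most four edges of the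
  shortest cycle meet the neighbourhood of \<open>v\<close>), or \<open>S(v) \<le> 2 m - d(v)\<close> if \<open>g = 3\<close>; the bound
  \<open>D + 2 = m - g + 3\<close> follows, except for \<open>m = 5\<close>, \<open>g = 3\<close>, which needs another test vector.
  On the other hand, the pendant cycle has an explicit eigenvector with eigenvalue
  \<open>q > m - g + 3\<close>, where \<open>q\<close> comes from the intermediate value theorem.
\<close>

section \<open>Eigenfunctions of the signless Laplacian\<close>

definition nbrs :: "'a pair_pre_digraph \<Rightarrow> 'a \<Rightarrow> 'a set" where
  "nbrs G v = {w. (v, w) \<in> parcs G}"

lemma nbrs_iff [simp]: "w \<in> nbrs G v \<longleftrightarrow> (v, w) \<in> parcs G"
  by (simp add: nbrs_def)

lemma out_degree_eq_card_nbrs: "out_degree (with_proj G) v = card (nbrs G v)"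
proof -
  have "out_arcs (with_proj G) v = Pair v ` nbrs G v"
    by (auto simp: out_arcs_def)
  then show ?thesis
    by (simp add: out_degree_def card_image inj_on_def)
qed

text \<open>Eigenvectors are indexed by vertices rather than by matrix rows, so the arbitrary
  enumeration \<open>vertex_list\<close> disappears from everything after
  \<open>eigenvalue_iff_eigenfunction\<close>.\<close>

definition eigenfunction :: "'a pair_pre_digraph \<Rightarrow> real \<Rightarrow> ('a \<Rightarrow> real) \<Rightarrow> bool" where
  "eigenfunction G k f \<longleftrightarrow> (\<exists>v \<in> pverts G. f v \<noteq> 0) \<and>
     (\<forall>v \<in> pverts G. real (card (nbrs G v)) * f v + (\<Sum>w \<in> nbrs G v. f w) = k * f v)"

lemma signless_laplacian_carrier:
  "signless_laplacian G \<in> carrier_mat (card (pverts G)) (card (pverts G))"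
  by (simp add: signless_laplacian_def adjacency_mat_def degree_mat_def)

context pair_graph
begin

lemma nbrs_subset_verts: "nbrs G v \<subseteq> pverts G"
  using wellformed' by auto

lemma finite_nbrs [simp]: "finite (nbrs G v)"
  by (rule finite_subset[OF nbrs_subset_verts pair_finite_verts])

lemma arcs_sym: "(u, v) \<in> parcs G \<longleftrightarrow> (v, u) \<in> parcs G"
  using arcs_symmetric by blast

lemma vertex_list: "distinct (vertex_list G)" "set (vertex_list G) = pverts G"
proof -
  have "\<exists>vs. distinct vs \<and> set vs = pverts G"
    using finite_distinct_list[OF pair_finite_verts] by blast
  from someI_ex[OF this] show "distinct (vertex_list G)" "set (vertex_list G) = pverts G"
    by (auto simp: vertex_list_def)
qed

lemma length_vertex_list: "length (vertex_list G) = card (pverts G)"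
  using vertex_list distinct_card by metis

lemma bij_betw_vertex_list: "bij_betw ((!) (vertex_list G)) {..<card (pverts G)} (pverts G)"
  using bij_betw_nth[OF vertex_list(1)] vertex_list(2) length_vertex_list by simp

lemma signless_laplacian_mult_vec:
  assumes x: "x = vec (card (pverts G)) (\<lambda>i. f (vertex_list G ! i))"
    and i: "i < card (pverts G)"
  defines "v \<equiv> vertex_list G ! i"
  shows "(signless_laplacian G *\<^sub>v x) $ i = real (card (nbrs G v)) * f v + (\<Sum>w \<in> nbrs G v. f w)"
proof -
  let ?n = "card (pverts G)" and ?vs = "vertex_list G"
  have "(signless_laplacian G *\<^sub>v x) $ i = (\<Sum>j<?n. ((if (v, ?vs ! j) \<in> parcs G then 1 else 0)
       + (if i = j then real (card (nbrs G v)) else 0)) * f (?vs ! j))"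
    using i by (auto simp: x v_def signless_laplacian_def adjacency_mat_def degree_mat_def
        scalar_prod_def out_degree_eq_card_nbrs lessThan_atLeast0 intro!: sum.cong)
  also have "\<dots> = (\<Sum>j<?n. (if (v, ?vs ! j) \<in> parcs G then f (?vs ! j) else 0))
      + (\<Sum>j<?n. if i = j then real (card (nbrs G v)) * f (?vs ! j) else 0)"
    unfolding sum.distrib[symmetric] by (intro sum.cong) (auto simp: algebra_simps)
  also have "(\<Sum>j<?n. (if (v, ?vs ! j) \<in> parcs G then f (?vs ! j) else 0))
      = (\<Sum>w\<in>pverts G. if (v, w) \<in> parcs G then f w else 0)"
    by (rule sum.reindex_bij_betw[OF bij_betw_vertex_list])
  also have "\<dots> = (\<Sum>w \<in> nbrs G v. f w)"
    using nbrs_subset_verts[of v] by (intro sum.mono_neutral_cong_right) (auto simp: pair_finite_verts)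
  finally show ?thesis
    using i by (simp add: v_def)
qed

lemma eigenvalue_iff_eigenfunction:
  "k \<in> spectrum (signless_laplacian G) \<longleftrightarrow> (\<exists>f. eigenfunction G k f)"
proof
  let ?n = "card (pverts G)" and ?vs = "vertex_list G"
  assume "k \<in> spectrum (signless_laplacian G)"
  then obtain x where x: "x \<in> carrier_vec ?n" "x \<noteq> 0\<^sub>v ?n" "signless_laplacian G *\<^sub>v x = k \<cdot>\<^sub>v x"
    using signless_laplacian_carrier[of G]
    by (auto simp: spectrum_def eigenvalue_def eigenvector_def)
  define f where "f v = x $ (the_inv_into {..<?n} ((!) ?vs) v)" for v
  have f: "f (?vs ! i) = x $ i" if "i < ?n" for i
    using that bij_betw_vertex_list by (auto simp: f_def bij_betw_def the_inv_into_f_f)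
  have xf: "x = vec ?n (\<lambda>i. f (?vs ! i))"
    using x(1) f by (intro eq_vecI) auto
  have surj: "\<exists>i<?n. v = ?vs ! i" if "v \<in> pverts G" for v
    using that bij_betw_vertex_list by (auto simp: bij_betw_def)
  obtain i where i: "i < ?n" "x $ i \<noteq> 0"
    using x(1,2) by (metis carrier_vecD eq_vecI index_zero_vec)
  then have "\<exists>v \<in> pverts G. f v \<noteq> 0"
    using f[of i] bij_betw_vertex_list by (metis bij_betwE lessThan_iff)
  moreover have "real (card (nbrs G v)) * f v + (\<Sum>w \<in> nbrs G v. f w) = k * f v"
    if "v \<in> pverts G" for v
  proof -
    obtain i where i: "i < ?n" "v = ?vs ! i"
      using surj[OF \<open>v \<in> pverts G\<close>] by blast
    have "(signless_laplacian G *\<^sub>v x) $ i = k * f v"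
      using i x f by simp
    then show ?thesis
      using signless_laplacian_mult_vec[OF xf i(1)] i(2) by simp
  qed
  ultimately show "\<exists>f. eigenfunction G k f"
    unfolding eigenfunction_def by blast
next
  let ?n = "card (pverts G)" and ?vs = "vertex_list G"
  assume "\<exists>f. eigenfunction G k f"
  then obtain f where f: "eigenfunction G k f" ..
  define x where "x = vec ?n (\<lambda>i. f (?vs ! i))"
  have in_verts: "?vs ! i \<in> pverts G" if "i < ?n" for i
    using that bij_betw_vertex_list by (metis bij_betwE lessThan_iff)
  obtain v where v: "v \<in> pverts G" "f v \<noteq> 0"
    using f by (auto simp: eigenfunction_def)
  then obtain i where i: "i < ?n" "v = ?vs ! i"
    using bij_betw_vertex_list by (auto simp: bij_betw_def)
  have "x \<noteq> 0\<^sub>v ?n"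
  proof
    assume "x = 0\<^sub>v ?n"
    then have "x $ i = 0\<^sub>v ?n $ i"
      by simp
    then show False
      using i v by (simp add: x_def)
  qed
  moreover have "signless_laplacian G *\<^sub>v x = k \<cdot>\<^sub>v x"
  proof (rule eq_vecI)
    fix i assume "i < dim_vec (k \<cdot>\<^sub>v x)"
    then have i: "i < ?n"
      by (simp add: x_def)
    show "(signless_laplacian G *\<^sub>v x) $ i = (k \<cdot>\<^sub>v x) $ i"
      unfolding signless_laplacian_mult_vec[OF x_def i]
      using f in_verts[OF i] i by (simp add: eigenfunction_def x_def)
  qed (use signless_laplacian_carrier[of G] in \<open>auto simp: x_def\<close>)
  ultimately show "k \<in> spectrum (signless_laplacian G)"
    using signless_laplacian_carrier[of G]
    by (auto simp: spectrum_def eigenvalue_def eigenvector_def x_def intro!: exI[of _ x])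
qed

end

text \<open>Over the complex numbers an eigenvalue \<open>k\<close> always exists. Symmetry makes
  the Hermitian form of its eigenvector real, so \<open>k\<close> is real and hence a root of the
  real characteristic polynomial. Without this, the \<open>Max\<close> in
  \<open>signless_radius\<close> might range over an empty set.\<close>

lemma real_symmetric_spectrum_non_empty:
  fixes A :: "real mat"
  assumes A: "A \<in> carrier_mat n n" and n: "n > 0"
    and sym: "\<And>i j. i < n \<Longrightarrow> j < n \<Longrightarrow> A $$ (i, j) = A $$ (j, i)"
  shows "spectrum A \<noteq> {}"
proof -
  let ?B = "map_mat complex_of_real A"
  have B: "?B \<in> carrier_mat n n"
    using A by simp
  obtain k where k: "k \<in> spectrum ?B"
    using spectrum_non_empty[OF B n] by auto
  then obtain x where x: "x \<in> carrier_vec n" "x \<noteq> 0\<^sub>v n" "?B *\<^sub>v x = k \<cdot>\<^sub>v x"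
    using B by (auto simp: spectrum_def eigenvalue_def eigenvector_def)
  have row: "(\<Sum>j<n. of_real (A $$ (i, j)) * x $ j) = k * x $ i" if i: "i < n" for i
  proof -
    have "(?B *\<^sub>v x) $ i = (\<Sum>j<n. of_real (A $$ (i, j)) * x $ j)"
      using i A x(1) by (auto simp: scalar_prod_def lessThan_atLeast0 intro!: sum.cong)
    then show ?thesis
      using x i by simp
  qed
  \<comment> \<open>\<open>T\<close> is the Hermitian form of \<open>A\<close> at \<open>x\<close>
    and \<open>N\<close> is the squared norm of \<open>x\<close>. The eigenvalue equation gives
    \<open>T = k * N\<close>, while swapping the two sums shows that \<open>T\<close> is
    real.\<close>
  define T where "T = (\<Sum>i<n. \<Sum>j<n. cnj (x $ i) * of_real (A $$ (i, j)) * x $ j)"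
  define N where "N = (\<Sum>i<n. (cmod (x $ i))\<^sup>2)"
  have "T = (\<Sum>i<n. cnj (x $ i) * (\<Sum>j<n. of_real (A $$ (i, j)) * x $ j))"
    by (simp add: T_def sum_distrib_left mult.assoc)
  also have "\<dots> = (\<Sum>i<n. k * of_real ((cmod (x $ i))\<^sup>2))"
    by (intro sum.cong refl) (simp add: row complex_norm_square del: of_real_power)
  also have "\<dots> = k * of_real N"
    by (simp add: N_def sum_distrib_left)
  finally have T: "T = k * of_real N" .
  have "cnj T = (\<Sum>i<n. \<Sum>j<n. cnj (x $ j) * of_real (A $$ (j, i)) * x $ i)"
    by (auto simp: T_def sym mult_ac intro!: sum.cong)
  also have "\<dots> = T"
    unfolding T_def by (rule sum.swap)
  finally have "cnj T = T" .
  moreover have "N > 0"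
  proof -
    obtain i where i: "i < n" "x $ i \<noteq> 0"
      using x(1,2) by (metis carrier_vecD eq_vecI index_zero_vec)
    then show ?thesis
      unfolding N_def by (intro sum_pos2[of _ i]) auto
  qed
  ultimately have "cnj k = k"
    using T by simp
  then have kr: "k = of_real (Re k)"
    by (simp add: complex_eq_iff)
  have "poly (char_poly ?B) k = 0"
    using k spectrum_root_char_poly[OF B] by simp
  then have "poly (map_poly complex_of_real (char_poly A)) (of_real (Re k)) = 0"
    using kr of_real_hom.char_poly_hom[OF A] by metis
  then have "poly (char_poly A) (Re k) = 0"
    by simp
  then show ?thesis
    using spectrum_root_char_poly[OF A] by auto
qed

section \<open>The spectral radius as a maximum, and upper bounds from positive weights\<close>

context pair_graph
begin

lemma finite_spectrum: "finite (spectrum (signless_laplacian G))"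
  by (rule card_finite_spectrum[OF signless_laplacian_carrier])

lemma spectrum_non_empty:
  assumes "pverts G \<noteq> {}"
  shows "spectrum (signless_laplacian G) \<noteq> {}"
proof (rule real_symmetric_spectrum_non_empty[OF signless_laplacian_carrier])
  show "card (pverts G) > 0"
    using assms pair_finite_verts by (simp add: card_gt_0_iff)
qed (auto simp: signless_laplacian_def adjacency_mat_def degree_mat_def arcs_sym)

lemma le_signless_radius: "eigenfunction G k f \<Longrightarrow> k \<le> signless_radius G"
  unfolding signless_radius_def using finite_spectrum eigenvalue_iff_eigenfunction by (blast intro: Max_ge)

text \<open>Collatz--Wielandt: compare the eigenfunction with \<open>x\<close> at a vertex where the ratio
  of their absolute values is largest.\<close>

lemma eigenvalue_le_weight_bound:
  assumes f: "eigenfunction G k f"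
    and pos: "\<And>v. v \<in> pverts G \<Longrightarrow> x v > 0"
    and le: "\<And>v. v \<in> pverts G \<Longrightarrow> real (card (nbrs G v)) * x v + (\<Sum>w \<in> nbrs G v. x w) \<le> B * x v"
  shows "k \<le> B"
proof -
  define r where "r v = \<bar>f v\<bar> / x v" for v
  obtain u where u: "u \<in> pverts G" "f u \<noteq> 0"
    using f by (auto simp: eigenfunction_def)
  obtain v where v: "v \<in> pverts G" "\<And>w. w \<in> pverts G \<Longrightarrow> r w \<le> r v"
    using finite_has_maximal2[of "r ` pverts G" "r u"] pair_finite_verts u(1)
    by (auto simp: not_less) (metis linorder_le_cases)
  have "r u > 0"
    using u pos by (simp add: r_def)
  then have rv: "r v > 0"
    using v(2)[OF u(1)] by simp
  have abs_f: "\<bar>f w\<bar> = r w * x w" if "w \<in> pverts G" for w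
    using pos[OF that] by (simp add: r_def)
  have "k * \<bar>f v\<bar> \<le> \<bar>k * f v\<bar>"
    by (simp add: abs_mult mult_right_mono)
  also have "\<dots> = \<bar>real (card (nbrs G v)) * f v + (\<Sum>w \<in> nbrs G v. f w)\<bar>"
    using f v(1) by (simp add: eigenfunction_def)
  also have "\<dots> \<le> real (card (nbrs G v)) * \<bar>f v\<bar> + (\<Sum>w \<in> nbrs G v. \<bar>f w\<bar>)"
    by (intro order.trans[OF abs_triangle_ineq] add_mono sum_abs) (simp add: abs_mult)
  also have "\<dots> \<le> real (card (nbrs G v)) * (r v * x v) + (\<Sum>w \<in> nbrs G v. r v * x w)"
  proof (intro add_mono sum_mono)
    fix w assume "w \<in> nbrs G v"
    then have w: "w \<in> pverts G"
      using nbrs_subset_verts by blast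
    show "\<bar>f w\<bar> \<le> r v * x w"
      unfolding abs_f[OF w] using v(2)[OF w] pos[OF w] by (simp add: mult_right_mono)
  qed (simp add: abs_f v)
  also have "\<dots> = r v * (real (card (nbrs G v)) * x v + (\<Sum>w \<in> nbrs G v. x w))"
    by (simp add: algebra_simps sum_distrib_left)
  also have "\<dots> \<le> r v * (B * x v)"
    using le[OF v(1)] rv by (simp add: mult_left_mono)
  finally have "k * (r v * x v) \<le> B * (r v * x v)"
    by (simp add: abs_f v algebra_simps)
  then show ?thesis
    using rv pos[OF v(1)] by (simp add: mult_le_cancel_right)
qed

text \<open>A finite non-empty spectrum contains its maximum, so the radius is itself an eigenvalue
  and the preceding bound applies to it.\<close>

lemma signless_radius_le_weight_bound:
  assumes "pverts G \<noteq> {}"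
    and "\<And>v. v \<in> pverts G \<Longrightarrow> x v > 0"
    and "\<And>v. v \<in> pverts G \<Longrightarrow> real (card (nbrs G v)) * x v + (\<Sum>w \<in> nbrs G v. x w) \<le> B * x v"
  shows "signless_radius G \<le> B"
proof -
  have "signless_radius G \<in> spectrum (signless_laplacian G)"
    unfolding signless_radius_def using finite_spectrum spectrum_non_empty[OF assms(1)] by (rule Max_in)
  then show ?thesis
    using eigenvalue_iff_eigenfunction eigenvalue_le_weight_bound assms(2,3) by blast
qed

end

text \<open>A library isomorphism moves vertices and arcs by separate maps. Here arcs are pairs with
  tail \<open>fst\<close> and head \<open>snd\<close>, so the vertex map determines the arc
  map.\<close>

lemma digraph_iso_with_proj_iff:
  assumes "pair_graph G"
  shows "digraph_iso (with_proj G) (with_proj H) \<longleftrightarrow>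
    (\<exists>f. inj_on f (pverts G) \<and> pverts H = f ` pverts G \<and> parcs H = map_prod f f ` parcs G)"
proof
  interpret pair_graph G by fact
  assume "digraph_iso (with_proj G) (with_proj H)"
  then obtain h where h: "digraph_isomorphism h" "with_proj H = app_iso h (with_proj G)"
    unfolding digraph_iso_def by blast
  have proj: "iso_tail h = fst" "iso_head h = snd"
    "pverts H = iso_verts h ` pverts G" "parcs H = iso_arcs h ` parcs G"
    using h(2) by (auto simp: app_iso_def with_proj_def)
  have "iso_arcs h a = map_prod (iso_verts h) (iso_verts h) a" if "a \<in> parcs G" for a
    using h(1) that by (auto simp: digraph_isomorphism_def proj map_prod_def prod_eq_iff split_beta)
  then have "parcs H = map_prod (iso_verts h) (iso_verts h) ` parcs G"
    unfolding proj(4) by (intro image_cong) auto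
  moreover have "inj_on (iso_verts h) (pverts G)"
    using h(1) by (simp add: digraph_isomorphism_def)
  ultimately show "\<exists>f. inj_on f (pverts G) \<and> pverts H = f ` pverts G \<and> parcs H = map_prod f f ` parcs G"
    using proj(3) by blast
next
  interpret pair_graph G by fact
  assume "\<exists>f. inj_on f (pverts G) \<and> pverts H = f ` pverts G \<and> parcs H = map_prod f f ` parcs G"
  then obtain f where f: "inj_on f (pverts G)" "pverts H = f ` pverts G" "parcs H = map_prod f f ` parcs G"
    by blast
  let ?h = "\<lparr>iso_verts = f, iso_arcs = map_prod f f, iso_head = snd, iso_tail = fst\<rparr>"
  have "inj_on (map_prod f f) (parcs G)"
    using wellformed' by (intro inj_on_subset[OF map_prod_inj_on[OF f(1) f(1)]]) auto
  then have "digraph_isomorphism ?h"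
    using f(1) wf_digraph_axioms by (auto simp: digraph_isomorphism_def)
  moreover have "with_proj H = app_iso ?h (with_proj G)"
    by (simp add: app_iso_def with_proj_def f)
  ultimately show "digraph_iso (with_proj G) (with_proj H)"
    unfolding digraph_iso_def by blast
qed

text \<open>Composition with the vertex bijection carries eigenfunctions of \<open>H\<close> to
  eigenfunctions of \<open>G\<close> with the same eigenvalue, so the spectra agree.\<close>

lemma digraph_iso_signless_radius:
  assumes G: "pair_graph G" and H: "pair_graph H"
    and iso: "digraph_iso (with_proj G) (with_proj H)"
  shows "signless_radius G = signless_radius H"
proof -
  interpret G: pair_graph G by fact
  interpret H: pair_graph H by fact
  obtain \<phi> where \<phi>: "inj_on \<phi> (pverts G)" "pverts H = \<phi> ` pverts G" "parcs H = map_prod \<phi> \<phi> ` parcs G"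
    using iso digraph_iso_with_proj_iff[OF G] by metis
  have nbrs: "nbrs H (\<phi> v) = \<phi> ` nbrs G v" if "v \<in> pverts G" for v
  proof -
    have "w \<in> nbrs H (\<phi> v) \<longleftrightarrow> w \<in> \<phi> ` nbrs G v" for w
    proof
      assume "w \<in> nbrs H (\<phi> v)"
      then obtain a b where ab: "(a, b) \<in> parcs G" "\<phi> a = \<phi> v" "w = \<phi> b"
        by (auto simp: \<phi>(3))
      then have "a = v"
        using \<phi>(1) that G.wellformed' by (auto dest: inj_onD)
      with ab show "w \<in> \<phi> ` nbrs G v"
        by auto
    qed (auto simp: \<phi>(3))
    then show ?thesis
      by blast
  qed
  have inj: "inj_on \<phi> (nbrs G v)" for v
    using \<phi>(1) G.nbrs_subset_verts inj_on_subset by blast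
  have pull: "eigenfunction H k f \<longleftrightarrow> eigenfunction G k (f \<circ> \<phi>)" for k f
    by (simp add: eigenfunction_def \<phi>(2) nbrs card_image[OF inj] sum.reindex[OF inj])
  \<comment> \<open>Every function on the vertices of \<open>G\<close> agrees there with one of the
    form \<open>h \<circ> \<phi>\<close>, so \<open>pull\<close> reaches every eigenfunction of
    \<open>G\<close> up to values off the vertices.\<close>
  have push: "eigenfunction G k f \<longleftrightarrow> eigenfunction G k ((f \<circ> the_inv_into (pverts G) \<phi>) \<circ> \<phi>)" for k f
  proof -
    have "(\<Sum>w\<in>nbrs G v. f (the_inv_into (pverts G) \<phi> (\<phi> w))) = sum f (nbrs G v)" for v
      using G.nbrs_subset_verts[of v] \<phi>(1) by (intro sum.cong) (auto simp: the_inv_into_f_f)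
    then show ?thesis
      using \<phi>(1) by (simp add: eigenfunction_def the_inv_into_f_f)
  qed
  have "k \<in> spectrum (signless_laplacian G) \<longleftrightarrow> k \<in> spectrum (signless_laplacian H)" for k
    unfolding G.eigenvalue_iff_eigenfunction H.eigenvalue_iff_eigenfunction
    using pull push by blast
  then have "spectrum (signless_laplacian G) = spectrum (signless_laplacian H)"
    by blast
  then show ?thesis
    by (simp add: signless_radius_def)
qed

section \<open>The spectral radius of the pendant cycle\<close>

lemma pair_graph_pendant_cycle:
  assumes "g \<ge> 3" "m \<ge> g"
  shows "pair_graph (pendant_cycle m g)"
proof
  show "finite (parcs (pendant_cycle m g))"
    by (rule finite_subset[of _ "{..<g + m} \<times> {..<g + m}"])
      (use assms in \<open>auto simp: pendant_cycle_def cycle_graph_def intro: trans_less_add1\<close>)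
  show "symmetric (with_proj (pendant_cycle m g))"
    by (auto simp: symmetric_def sym_def pendant_cycle_def cycle_graph_def arcs_ends_def arc_to_ends_def)
qed (use assms in \<open>auto simp: pendant_cycle_def cycle_graph_def mod_Suc split: if_splits\<close>)

lemma nbrs_pendant_cycle_center:
  assumes "g \<ge> 3"
  shows "nbrs (pendant_cycle m g) 0 = {1, g - 1} \<union> {g..<m}"
  using assms by (auto simp: pendant_cycle_def cycle_graph_def mod_Suc nbrs_def split: if_splits)

lemma nbrs_pendant_cycle_cycle:
  assumes "g \<ge> 3" "0 < i" "i < g"
  shows "nbrs (pendant_cycle m g) i = {i - 1, Suc i mod g}"
  using assms by (auto simp: pendant_cycle_def cycle_graph_def mod_Suc nbrs_def split: if_splits)

lemma nbrs_pendant_cycle_pendant: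
  assumes "g \<ge> 3" "g \<le> i" "i < m"
  shows "nbrs (pendant_cycle m g) i = {0}"
  using assms by (auto simp: pendant_cycle_def cycle_graph_def mod_Suc nbrs_def split: if_splits)

text \<open>With \<open>q = 2 + t + 1 / t\<close>, the values \<open>t ^ i + t ^ (g - i)\<close> solve the eigenvalue equation
  for \<open>q\<close> at every vertex of the cycle except the center, and the pendent vertices are forced.
  The hypothesis is the remaining equation at the center.\<close>

lemma pendant_cycle_eigenfunction:
  fixes t :: real
  assumes g: "g \<ge> 3" and m: "m \<ge> g" and t: "t > 0"
    and q: "q = 2 + t + 1 / t"
    and center: "(2 + real (m - g) - q) * (1 + t ^ g) + 2 * (t + t ^ (g - 1))
      + real (m - g) * ((1 + t ^ g) / (q - 1)) = 0"
  shows "eigenfunction (pendant_cycle m g) q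
    (\<lambda>i. if i < g then t ^ i + t ^ (g - i) else (1 + t ^ g) / (q - 1))"
    (is "eigenfunction ?P q ?f")
proof -
  have verts: "pverts ?P = {..<m}"
    using m by (auto simp: pendant_cycle_def cycle_graph_def)
  have q1: "q - 1 > 0"
    using t q by (simp add: add_pos_pos)
  have "real (card (nbrs ?P v)) * ?f v + (\<Sum>w\<in>nbrs ?P v. ?f w) = q * ?f v" if "v < m" for v
  proof -
    consider "v = 0" | "0 < v" "v < g" | "g \<le> v"
      by linarith
    then show ?thesis
    proof cases
      case 1
      have c: "card (nbrs ?P 0) = 2 + (m - g)"
        unfolding nbrs_pendant_cycle_center[OF g] using g by (subst card_Un_disjoint) auto
      have "(\<Sum>w\<in>nbrs ?P 0. ?f w) = (\<Sum>w\<in>{1, g - 1}. ?f w) + (\<Sum>w\<in>{g..<m}. ?f w)"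
        unfolding nbrs_pendant_cycle_center[OF g] using g by (intro sum.union_disjoint) auto
      also have "(\<Sum>w\<in>{1, g - 1}. ?f w) = 2 * (t + t ^ (g - 1))"
        using g by simp
      also have "(\<Sum>w\<in>{g..<m}. ?f w) = real (m - g) * ((1 + t ^ g) / (q - 1))"
        by simp
      finally show ?thesis
        using g center unfolding 1 c by (simp add: algebra_simps)
    next
      case 2
      have ne: "v - 1 \<noteq> Suc v mod g"
        using 2 g by (auto simp: mod_Suc)
      obtain a where a: "v = Suc a"
        using 2 by (cases v) auto
      \<comment> \<open>With \<open>v = a + 1\<close> and \<open>g - v = b + 1\<close>, all
        exponents involved become explicit successors and no truncated subtraction is left.\<close>
      obtain b where b: "g = Suc a + Suc b"
        using 2 a that[of "g - a - 2"] by linarith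
      \<comment> \<open>The wrap-around at \<open>v = g - 1\<close> is harmless: the formula takes
        the same value \<open>1 + t ^ g\<close> at the indices \<open>0\<close> and
        \<open>g\<close>.\<close>
      have next_v: "?f (Suc v mod g) = t ^ Suc v + t ^ (g - Suc v)"
        using 2 by (auto simp: mod_Suc)
      have "(\<Sum>w\<in>nbrs ?P v. ?f w) = ?f (v - 1) + ?f (Suc v mod g)"
        unfolding nbrs_pendant_cycle_cycle[OF g 2] using ne by simp
      also have "\<dots> = (t + 1 / t) * (t ^ v + t ^ (g - v))"
        unfolding next_v using 2 t by (simp add: a b field_simps power2_eq_square)
      finally show ?thesis
        unfolding nbrs_pendant_cycle_cycle[OF g 2] using ne 2 by (simp add: q algebra_simps)
    next
      case 3
      then show ?thesis
        unfolding nbrs_pendant_cycle_pendant[OF g 3 that] using q1 g by (simp add: field_simps)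
    qed
  qed
  moreover have "?f 0 \<noteq> 0"
    using g t by (simp add: add_pos_pos less_imp_neq[symmetric])
  ultimately show ?thesis
    unfolding eigenfunction_def verts using g m by (intro conjI bexI[of _ 0]) auto
qed

text \<open>Here \<open>k\<close> is the number of pendent vertices, and the last equation is the
  one at the center. Its left side \<open>\<Phi>\<close> is positive at the \<open>s\<close> where
  \<open>2 + s + 1 / s\<close> equals \<open>k + 3\<close> and negative at \<open>k + 4\<close>. A
  zero strictly between gives a larger value, because \<open>t + 1 / t\<close> increases for
  \<open>t \<ge> 1\<close>.\<close>

lemma pendant_cycle_eigenvalue_param_exists:
  fixes k :: real
  assumes g: "g \<ge> 3" and k: "k \<ge> 1"
  obtains t where "t > 0" "2 + t + 1 / t > k + 3"
    "(2 + k - (2 + t + 1 / t)) * (1 + t ^ g) + 2 * (t + t ^ (g - 1))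
      + k * ((1 + t ^ g) / (2 + t + 1 / t - 1)) = 0"
proof -
  define \<Phi> where "\<Phi> t = (2 + k - (2 + t + 1 / t)) * (1 + t ^ g) + 2 * (t + t ^ (g - 1))
      + k * ((1 + t ^ g) / (2 + t + 1 / t - 1))" for t :: real
  obtain n where n: "g = Suc (Suc n)"
    using g that[of "g - 2"] by linarith
  \<comment> \<open>At \<open>s = 1\<close> the sum is 2, which is at most \<open>k + 1\<close>; at
    \<open>s = k + 1\<close> it exceeds \<open>k + 1\<close>.\<close>
  have "\<exists>s\<ge>1. s \<le> k + 1 \<and> s + 1 / s = k + 1"
    by (rule IVT') (use k in \<open>auto intro!: continuous_intros\<close>)
  then obtain s where s: "s \<ge> 1" "s \<le> k + 1" "s + 1 / s = k + 1"
    by blast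
  have "\<Phi> s > 0"
  proof -
    have k2: "k + 2 = s + 1 / s + 1"
      using s by simp
    have "(s + 1 / s + 1) * (s + s ^ (g - 1)) = 1 + s ^ g + (s\<^sup>2 + s ^ n + s + s ^ Suc n)"
      using s(1) by (simp add: n field_simps power2_eq_square)
    moreover have "s\<^sup>2 + s ^ n + s + s ^ Suc n > 0"
      using s(1) by (intro add_pos_pos zero_less_power) auto
    ultimately have "(k + 2) * (s + s ^ (g - 1)) > 1 + s ^ g"
      unfolding k2 by linarith
    then have *: "s + s ^ (g - 1) > (1 + s ^ g) / (k + 2)"
      using k by (simp add: field_simps)
    have q: "2 + s + 1 / s = k + 3"
      using s by simp
    \<comment> \<open>At this point the first factor \<open>2 + k - q\<close> is -1, and
      \<open>k / (k + 2) - 1 = - 2 / (k + 2)\<close>.\<close>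
    have \<Phi>: "\<Phi> s = 2 * (s + s ^ (g - 1) - (1 + s ^ g) / (k + 2))"
      unfolding \<Phi>_def q using k by (simp add: field_simps)
    show ?thesis
      unfolding \<Phi> using * by (simp only: zero_less_mult_iff zero_less_numeral diff_gt_0_iff_gt simp_thms)
  qed
  \<comment> \<open>At \<open>k + 4\<close> the first factor is below -4, while the other two
    summands are at most 2 and 1 times \<open>1 + ?T ^ g\<close>. This is why 4 suffices.\<close>
  moreover have "\<Phi> (k + 4) < 0"
  proof -
    let ?T = "k + 4"
    have "(?T ^ Suc n - 1) * (?T - 1) \<ge> 0"
      using k one_le_power[of ?T "Suc n"] by (intro mult_nonneg_nonneg) linarith+
    then have 1: "2 * (?T + ?T ^ (g - 1)) \<le> 2 * (1 + ?T ^ g)"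
      by (simp add: n algebra_simps)
    have pos: "1 + ?T ^ g > 0"
      using k by (simp add: add_pos_pos)
    have inv: "1 / ?T > 0"
      using k by simp
    have "k / (2 + ?T + i - 1) \<le> 1" if "i > 0" for i
      using that k by (simp add: divide_le_eq_1)
    from this[OF inv] have "k / (2 + ?T + 1 / ?T - 1) * (1 + ?T ^ g) \<le> 1 * (1 + ?T ^ g)"
      using pos by (intro mult_right_mono) auto
    then have 2: "k * ((1 + ?T ^ g) / (2 + ?T + 1 / ?T - 1)) \<le> 1 + ?T ^ g"
      by simp
    have 3: "(2 + k - (2 + ?T + 1 / ?T)) * (1 + ?T ^ g) \<le> (- 4) * (1 + ?T ^ g)"
      using pos inv by (intro mult_right_mono) auto
    have "\<Phi> ?T \<le> (- 4) * (1 + ?T ^ g) + 2 * (1 + ?T ^ g) + (1 + ?T ^ g)"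
      unfolding \<Phi>_def by (intro add_mono 1 2 3)
    also have "\<dots> = - (1 + ?T ^ g)"
      by simp
    also have "\<dots> < 0"
      using pos by simp
    finally show ?thesis .
  qed
  moreover have "continuous_on {s..k + 4} \<Phi>"
  proof -
    have "2 + t + 1 / t - 1 \<noteq> 0" if "t \<ge> s" for t
    proof -
      have "1 / t > 0"
        using that s(1) by simp
      then show ?thesis
        using that s(1) by linarith
    qed
    then show ?thesis
      unfolding \<Phi>_def using s(1) by (auto intro!: continuous_intros)
  qed
  ultimately obtain t where t: "s \<le> t" "\<Phi> t = 0"
    using IVT2'[of \<Phi> "k + 4" 0 s] s(2) by fastforce
  then have st: "s < t"
    using \<open>\<Phi> s > 0\<close> by (cases "s = t") auto
  \<comment> \<open>This factorization is the strict monotonicity of \<open>t + 1 / t\<close> beyond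
    1.\<close>
  have "t + 1 / t - (s + 1 / s) = (t - s) * (1 - 1 / (s * t))"
    using s(1) st by (simp add: field_simps)
  moreover have "s * t > 1"
    using mult_right_mono[of 1 s t] s(1) st by linarith
  then have "1 / (s * t) < 1"
    by simp
  then have "(t - s) * (1 - 1 / (s * t)) > 0"
    using st by (intro mult_pos_pos) auto
  ultimately have "2 + t + 1 / t > k + 3"
    using s(3) by linarith
  then show ?thesis
    using that[of t] t(2) st s(1) unfolding \<Phi>_def by auto
qed

text \<open>The first bound is the one that graphs of small degree cannot exceed, except for
  \<open>m = 5\<close>, \<open>g = 3\<close>: there K4 minus an edge has radius 3 + sqrt 5, about
  5.236, which is above 5. The value 21 / 4 separates that radius from the one of the pendant
  cycle.\<close>

lemma pendant_cycle_signless_radius_gt: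
  assumes g: "g \<ge> 3" and m: "m > g"
  shows "signless_radius (pendant_cycle m g) > real (m - g) + 3"
    and "m = 5 \<Longrightarrow> g = 3 \<Longrightarrow> signless_radius (pendant_cycle m g) > 21 / 4"
proof -
  interpret pair_graph "pendant_cycle m g"
    using pair_graph_pendant_cycle g m by simp
  have "real (m - g) \<ge> 1"
    using m by simp
  then obtain t where t: "t > 0" "2 + t + 1 / t > real (m - g) + 3"
    "(2 + real (m - g) - (2 + t + 1 / t)) * (1 + t ^ g) + 2 * (t + t ^ (g - 1))
      + real (m - g) * ((1 + t ^ g) / (2 + t + 1 / t - 1)) = 0"
    using pendant_cycle_eigenvalue_param_exists[OF g] by blast
  have q: "2 + t + 1 / t \<le> signless_radius (pendant_cycle m g)"
    using le_signless_radius[OF pendant_cycle_eigenfunction[OF g _ t(1) refl t(3)]] m by simp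
  then show "signless_radius (pendant_cycle m g) > real (m - g) + 3"
    using t(2) by linarith
  assume mg: "m = 5" "g = 3"
  define q where "q = 2 + t + 1 / t"
  have q5: "q > 5"
    using t(2) by (simp add: q_def mg)
  \<comment> \<open>Since \<open>t * (q - 3) = t\<^sup>2 - t + 1\<close>, this is the factorization
    of \<open>1 + t ^ 3\<close>. It eliminates \<open>t\<close> from the center equation and leaves
    a cubic in \<open>q\<close>.\<close>
  have "t * (q - 3) * (1 + t) = 1 + t ^ 3"
    using t(1) by (simp add: q_def field_simps power3_eq_cube)
  then have t3: "1 + t ^ 3 = (q - 3) * (t + t\<^sup>2)"
    by (simp add: algebra_simps power2_eq_square)
  have "(4 - q) * (1 + t ^ 3) + 2 * (t + t\<^sup>2) + 2 * ((1 + t ^ 3) / (q - 1)) = 0"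
    using t(3) by (simp add: mg q_def[symmetric])
  then have "(t + t\<^sup>2) * ((4 - q) * (q - 3) + 2 + 2 * (q - 3) / (q - 1)) = 0"
    unfolding t3 by (simp add: algebra_simps)
  moreover have "t + t\<^sup>2 > 0"
    using t(1) by (simp add: add_pos_pos)
  ultimately have "(4 - q) * (q - 3) + 2 + 2 * (q - 3) / (q - 1) = 0"
    by simp
  then have "(q - 4) * (q - 3) * (q - 1) = 4 * q - 8"
    using q5 by (simp add: field_simps)
  \<comment> \<open>The bound on the right is 765 / 64, which is less than 12, whereas
    \<open>q > 5\<close> makes \<open>4 * q - 8\<close> exceed 12.\<close>
  moreover have "(q - 4) * (q - 3) * (q - 1) \<le> (5 / 4) * (9 / 4) * (17 / 4)" if "q \<le> 21 / 4"
    using that q5 by (intro mult_mono) auto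
  ultimately have "q > 21 / 4"
    using q5 by fastforce
  then show "signless_radius (pendant_cycle m g) > 21 / 4"
    using q unfolding q_def by linarith
qed

section \<open>Shortest cycles\<close>

text \<open>Indexing a cycle by residues turns rotations, chords and shortcuts into arithmetic on
  indices, with no walks involved.\<close>

definition cycle_embedding :: "'a pair_pre_digraph \<Rightarrow> nat \<Rightarrow> (nat \<Rightarrow> 'a) \<Rightarrow> bool" where
  "cycle_embedding G n c \<longleftrightarrow>
     n \<ge> 3 \<and> inj_on c {..<n} \<and> (\<forall>i<n. (c i, c (Suc i mod n)) \<in> parcs G)"

lemma inj_on_add_mod: "inj_on (\<lambda>i. (i + a) mod n) {..<n::nat}"
proof (rule linorder_inj_onI)
  fix x y assume "x < y" "x \<in> {..<n}" "y \<in> {..<n}"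
  then have "\<not> n dvd (y + a) - (x + a)"
    by (auto dest: dvd_imp_le)
  then show "(x + a) mod n \<noteq> (y + a) mod n"
    using mod_eq_dvd_iff_nat[of "x + a" "y + a" n] \<open>x < y\<close> by auto
qed auto

text \<open>This allows any chosen vertex of the cycle to be placed at index 0.\<close>

lemma cycle_embedding_rotate:
  assumes "cycle_embedding G n c"
  shows "cycle_embedding G n (\<lambda>i. c ((i + a) mod n))"
proof -
  have n: "n \<ge> 3"
    using assms by (simp add: cycle_embedding_def)
  have "(\<lambda>i. (i + a) mod n) ` {..<n} \<subseteq> {..<n}"
    by auto
  then have "inj_on (c \<circ> (\<lambda>i. (i + a) mod n)) {..<n}"
    using assms comp_inj_on[OF inj_on_add_mod] inj_on_subset unfolding cycle_embedding_def by blast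
  moreover have "(c ((i + a) mod n), c ((Suc i mod n + a) mod n)) \<in> parcs G" for i
  proof -
    have "(Suc i mod n + a) mod n = Suc ((i + a) mod n) mod n"
      by (simp add: mod_simps)
    then show ?thesis
      using assms n by (simp add: cycle_embedding_def)
  qed
  ultimately show ?thesis
    using n by (simp add: cycle_embedding_def comp_def)
qed

context pair_graph
begin

lemma cas_consecutive:
  "cas (d a) (map (\<lambda>i. (d i, d (Suc i))) [a..<a + k]) (d (a + k))"
proof (induction k arbitrary: a)
  case (Suc k)
  have "[a..<a + Suc k] = a # [Suc a..<Suc a + k]"
    by (simp add: upt_conv_Cons)
  then show ?case
    using Suc[of "Suc a"] by simp
qed simp

lemma girth_le_of_cycle_embedding:
  assumes "cycle_embedding G n c"
  shows "girth G \<le> enat n"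
proof -
  \<comment> \<open>The periodic extension makes the last arc return to \<open>d 0\<close> without a
    case distinction.\<close>
  define d where "d i = c (i mod n)" for i
  define p where "p = map (\<lambda>i. (d i, d (Suc i))) [0..<n]"
  have n: "n \<ge> 3" and arc: "\<And>i. i < n \<Longrightarrow> (c i, c (Suc i mod n)) \<in> parcs G"
    using assms by (auto simp: cycle_embedding_def)
  have "cas (d 0) p (d 0)"
    using cas_consecutive[of d 0 n] by (simp add: p_def d_def)
  moreover have "set p \<subseteq> parcs G"
    using arc by (auto simp: p_def d_def)
  moreover have "d 0 \<in> pverts G"
    using arc[of 0] n wellformed' by (auto simp: d_def)
  ultimately have walk: "awalk (d 0) p (d 0)"
    by (simp add: awalk_def)
  have "tl (awalk_verts (d 0) p) = map (\<lambda>i. d (Suc i)) [0..<n]"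
    using awalk_verts_conv'[OF \<open>cas (d 0) p (d 0)\<close>] n by (simp add: p_def comp_def)
  \<comment> \<open>Dropping the first vertex of the walk leaves the cycle rotated by one
    position.\<close>
  moreover have "inj_on (\<lambda>i. d (Suc i)) {0..<n}"
    using cycle_embedding_rotate[OF assms, of 1]
    by (simp add: cycle_embedding_def d_def lessThan_atLeast0)
  ultimately have "distinct (tl (awalk_verts (d 0) p))"
    by (simp add: distinct_map)
  then have "cycle p"
    using walk n unfolding cycle_def by (auto simp: p_def)
  then have "enat n \<in> (\<lambda>p. enat (length p)) ` {p. cycle p \<and> 3 \<le> length p}"
    using n by (intro image_eqI[of _ _ p]) (auto simp: p_def)
  then show ?thesis
    unfolding girth_def by (rule Inf_lower)
qed

lemma cas_nth:
  "cas u p v \<Longrightarrow> i < length p \<Longrightarrow> snd (p ! i) = (if Suc i = length p then v else fst (p ! Suc i))"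
proof (induction p arbitrary: u i)
  case (Cons a p)
  then show ?case
    by (cases i; cases p) auto
qed simp

text \<open>The infimum is finite, hence taken over a non-empty set, and the well-order on
  \<open>enat\<close> makes it a member.\<close>

lemma girth_attained:
  assumes "girth G = enat n"
  obtains c where "cycle_embedding G n c"
proof -
  let ?A = "(\<lambda>p. enat (length p)) ` {p. cycle p \<and> 3 \<le> length p}"
  have inf: "Inf ?A = enat n"
    using assms by (simp add: girth_def)
  then have "?A \<noteq> {}"
    by (metis Inf_empty enat.distinct(2) top_enat_def)
  then obtain a where "a \<in> ?A"
    by (meson ex_in_conv)
  then have "Inf ?A \<in> ?A"
    by (rule wellorder_InfI)
  then obtain p where p: "cycle p" "length p = n" "n \<ge> 3"
    unfolding inf by auto
  then obtain u where u: "awalk u p u" "distinct (tl (awalk_verts u p))"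
    by (auto simp: cycle_def)
  then have cas: "cas u p u" and arcs: "set p \<subseteq> parcs G"
    by (auto simp: awalk_def)
  \<comment> \<open>The heads of the arcs are used because \<open>cycle\<close> asserts distinctness
    of the vertex list without its first entry.\<close>
  define c where "c i = snd (p ! i)" for i
  have "tl (awalk_verts u p) = map snd p"
    using awalk_verts_conv'[OF cas] p by (auto split: if_splits)
  then have "inj_on c {..<n}"
    using u(2) p(2) by (auto simp: c_def inj_on_def distinct_conv_nth)
  moreover have "(c i, c (Suc i mod n)) \<in> parcs G" if "i < n" for i
  proof -
    have "fst (p ! 0) = u"
      using cas p by (cases p) auto
    then have "fst (p ! (Suc i mod n)) = c i"
      using cas_nth[OF cas, of i] that p(2) by (auto simp: c_def mod_Suc)
    then have "p ! (Suc i mod n) = (c i, c (Suc i mod n))"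
      by (simp add: c_def prod_eq_iff)
    moreover have "Suc i mod n < length p"
      using p by simp
    ultimately show ?thesis
      using arcs nth_mem by fastforce
  qed
  ultimately show ?thesis
    using that p(3) by (auto simp: cycle_embedding_def)
qed

end

section \<open>Degrees and edges near a shortest cycle\<close>

text \<open>Degrees become sizes of subsets of \<open>edges G\<close>, so that they can be counted
  against the total number of edges.\<close>

definition star :: "'a pair_pre_digraph \<Rightarrow> 'a \<Rightarrow> 'a set set" where
  "star G v = (\<lambda>w. {v, w}) ` nbrs G v"

context pair_graph
begin

lemma edges_iff: "{u, v} \<in> edges G \<longleftrightarrow> (u, v) \<in> parcs G"
  using arcs_sym by (auto simp: edges_def doubleton_eq_iff)

lemma finite_edges: "finite (edges G)"
proof -
  have "edges G = (\<lambda>(u, v). {u, v}) ` parcs G"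
    by (auto simp: edges_def)
  then show ?thesis
    using pair_finite_arcs by simp
qed

lemma card_star: "card (star G v) = card (nbrs G v)"
  unfolding star_def by (intro card_image) (auto simp: inj_on_def doubleton_eq_iff)

lemma star_eq: "star G v = {e \<in> edges G. v \<in> e}"
proof (intro equalityI subsetI)
  fix e assume "e \<in> {e \<in> edges G. v \<in> e}"
  then obtain u w where "e = {u, w}" "(u, w) \<in> parcs G" "v = u \<or> v = w"
    by (auto simp: edges_def)
  then have "\<exists>w \<in> nbrs G v. e = {v, w}"
    using arcs_sym by (auto simp: insert_commute)
  then show "e \<in> star G v"
    by (auto simp: star_def)
qed (auto simp: star_def edges_iff)

lemma star_subset_edges: "star G v \<subseteq> edges G"
  by (auto simp: star_eq)

lemma finite_star: "finite (star G v)"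
  by (simp add: star_def)

lemma star_Int_star: "u \<noteq> v \<Longrightarrow> star G u \<inter> star G v \<subseteq> {{u, v}}"
  by (auto simp: star_def doubleton_eq_iff)

lemma card_star_Int_star: "u \<noteq> v \<Longrightarrow> card (star G u \<inter> star G v) \<le> 1"
  using card_mono[OF _ star_Int_star, of u v] by simp

lemma star_Int_star_nonadjacent:
  "u \<noteq> v \<Longrightarrow> (u, v) \<notin> parcs G \<Longrightarrow> star G u \<inter> star G v = {}"
  by (auto simp: star_def doubleton_eq_iff)

lemma card_arcs_le: "card (parcs G) \<le> 2 * card (edges G)"
proof -
  have "parcs G \<subseteq> (\<Union>e\<in>edges G. {a. {fst a, snd a} = e})"
    by (auto simp: edges_iff)
  moreover have small: "finite {a. {fst a, snd a} = e} \<and> card {a. {fst a, snd a} = e} \<le> 2"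
    if "e \<in> edges G" for e :: "'a set"
  proof -
    obtain u v where e: "e = {u, v}"
      using \<open>e \<in> edges G\<close> by (auto simp: edges_def)
    have "{a. {fst a, snd a} = e} \<subseteq> {(u, v), (v, u)}"
      by (auto simp: e doubleton_eq_iff)
    moreover have "card {(u, v), (v, u)} \<le> 2"
      using card_insert_le_m1[of 2 "{(v, u)}" "(u, v)"] by simp
    ultimately show ?thesis
      by (meson card_mono finite.emptyI finite.insertI finite_subset le_trans)
  qed
  ultimately have "card (parcs G) \<le> card (\<Union>e\<in>edges G. {a. {fst a, snd a} = e})"
    using finite_edges by (intro card_mono) auto
  also have "\<dots> \<le> (\<Sum>e\<in>edges G. card {a. {fst a, snd a} = e})"
    by (rule card_UN_le[OF finite_edges])
  also have "\<dots> \<le> (\<Sum>e\<in>edges G. 2)"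
    using small by (intro sum_mono) auto
  finally show ?thesis
    by simp
qed

lemma sum_degrees: "(\<Sum>v\<in>pverts G. card (nbrs G v)) = card (parcs G)"
proof -
  have "parcs G = Sigma (pverts G) (nbrs G)"
    using wellformed' by auto
  then show ?thesis
    by (simp add: pair_finite_verts)
qed

text \<open>As \<open>v\<close> is not its own neighbour, the left side is part of the sum of all
  degrees. This estimate serves the case \<open>g = 3\<close>.\<close>

lemma sum_nbr_degrees_le:
  assumes "v \<in> pverts G"
  shows "(\<Sum>w\<in>nbrs G v. card (nbrs G w)) + card (nbrs G v) \<le> 2 * card (edges G)"
proof -
  have v: "v \<notin> nbrs G v"
    using no_loops' by auto
  have "(\<Sum>w\<in>nbrs G v. card (nbrs G w)) + card (nbrs G v)
      = (\<Sum>w\<in>insert v (nbrs G v). card (nbrs G w))"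
    using v by simp
  also have "\<dots> \<le> (\<Sum>w\<in>pverts G. card (nbrs G w))"
    using assms nbrs_subset_verts pair_finite_verts by (intro sum_mono2) auto
  finally show ?thesis
    using sum_degrees card_arcs_le by linarith
qed

end

section \<open>Neighbourhoods and edge counts around a fixed shortest cycle\<close>

locale girth_cycle = pair_graph G for G :: "'a pair_pre_digraph" +
  fixes g :: nat and c :: "nat \<Rightarrow> 'a"
  assumes embedding: "cycle_embedding G g c"
    and minimal: "\<And>n d. cycle_embedding G n d \<Longrightarrow> g \<le> n"
begin

definition C :: "'a set" where "C = c ` {..<g}"

definition cedge :: "nat \<Rightarrow> 'a set" where "cedge i = {c i, c (Suc i mod g)}"

definition CE :: "'a set set" where "CE = cedge ` {..<g}"

lemma g3: "g \<ge> 3"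
  using embedding by (simp add: cycle_embedding_def)

lemma c_inj: "i < g \<Longrightarrow> j < g \<Longrightarrow> c i = c j \<longleftrightarrow> i = j"
  using embedding by (auto simp: cycle_embedding_def inj_on_def)

lemma arc: "i < g \<Longrightarrow> (c i, c (Suc i mod g)) \<in> parcs G"
  using embedding by (simp add: cycle_embedding_def)

lemma arc_Suc: "Suc i < g \<Longrightarrow> (c i, c (Suc i)) \<in> parcs G"
  using arc[of i] by simp

lemma Suc_mod_less: "Suc i mod g < g"
  using g3 by simp

lemma card_CE: "card CE = g"
proof -
  have "inj_on cedge {..<g}"
  proof (rule inj_onI)
    fix i j assume ij: "i \<in> {..<g}" "j \<in> {..<g}" "cedge i = cedge j"
    \<comment> \<open>Equal edges could also match with their ends exchanged; that would need
      \<open>g = 2\<close>.\<close>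
    then have "(i = j \<and> Suc i mod g = Suc j mod g) \<or> (i = Suc j mod g \<and> Suc i mod g = j)"
      using c_inj Suc_mod_less by (auto simp: cedge_def doubleton_eq_iff)
    then show "i = j"
      using ij g3 by (auto simp: mod_Suc split: if_splits)
  qed
  then show ?thesis
    by (simp add: CE_def card_image)
qed

lemma finite_CE: "finite CE"
  by (simp add: CE_def)

lemma CE_subset_edges: "CE \<subseteq> edges G"
  using arc by (auto simp: CE_def cedge_def edges_iff)

lemma CE_subset_C: "e \<in> CE \<Longrightarrow> e \<subseteq> C"
  using Suc_mod_less by (auto simp: CE_def cedge_def C_def)

lemma card_star_Int_CE: "card (star G v \<inter> CE) \<le> 2"
proof (cases "v \<in> C")
  case True
  then obtain a where a: "a < g" "v = c a"
    by (auto simp: C_def)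
  \<comment> \<open>\<open>(a + g - 1) mod g\<close> is the predecessor of \<open>a\<close> on the
    cycle; adding \<open>g\<close> first makes this correct for \<open>a = 0\<close>.\<close>
  have "star G v \<inter> CE \<subseteq> {cedge a, cedge ((a + g - 1) mod g)}"
  proof
    fix e assume "e \<in> star G v \<inter> CE"
    then obtain i where i: "i < g" "e = cedge i" "v \<in> e"
      by (auto simp: CE_def star_eq)
    then consider "a = i" | "a = Suc i mod g"
      using a c_inj Suc_mod_less by (auto simp: cedge_def)
    then show "e \<in> {cedge a, cedge ((a + g - 1) mod g)}"
    proof cases
      case 2
      then have "(a + g - 1) mod g = i"
        using i(1) g3 by (auto simp: mod_Suc)
      then show ?thesis
        using i by simp
    qed (use i in simp)
  qed
  then have "card (star G v \<inter> CE) \<le> card {cedge a, cedge ((a + g - 1) mod g)}"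
    by (intro card_mono) auto
  then show ?thesis
    by (simp add: card_insert_if split: if_splits)
next
  case False
  then have "star G v \<inter> CE = {}"
    using CE_subset_C by (auto simp: star_eq)
  then show ?thesis
    by simp
qed

text \<open>A chord closes the path from \<open>c i\<close> to \<open>c j\<close> into a cycle of
  length \<open>j - i + 1\<close>, which is shorter than \<open>g\<close> unless the path is the
  whole cycle.\<close>

lemma no_chord:
  assumes "i < j" "j < g" "(c i, c j) \<in> parcs G"
  shows "j = Suc i \<or> i = 0 \<and> j = g - 1"
proof (rule ccontr)
  assume neg: "\<not> ?thesis"
  define n where "n = Suc (j - i)"
  have "cycle_embedding G n (\<lambda>k. c (i + k))"
    unfolding cycle_embedding_def
  proof (intro conjI allI impI)
    show "n \<ge> 3"
      using assms neg by (auto simp: n_def)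
    show "inj_on (\<lambda>k. c (i + k)) {..<n}"
      using c_inj assms by (auto simp: inj_on_def n_def)
    fix k assume k: "k < n"
    show "(c (i + k), c (i + Suc k mod n)) \<in> parcs G"
    proof (cases "Suc k = n")
      case True
      then have "i + k = j"
        using assms by (simp add: n_def)
      then show ?thesis
        using True assms(3) arcs_sym by simp
    next
      case False
      then show ?thesis
        using k assms arc_Suc[of "i + k"] by (simp add: n_def)
    qed
  qed
  then have "g \<le> n"
    by (rule minimal)
  then show False
    using assms neg by (auto simp: n_def)
qed

lemma nbrs_on_cycle:
  assumes a: "a < g"
  shows "nbrs G (c a) \<inter> C \<subseteq> {c (Suc a mod g), c ((a + g - 1) mod g)}"
proof
  fix w assume "w \<in> nbrs G (c a) \<inter> C"
  then obtain j where j: "j < g" "w = c j" "(c a, c j) \<in> parcs G"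
    by (auto simp: C_def)
  then have "j \<noteq> a"
    using no_loops' by auto
  then consider "a < j" | "j < a"
    by linarith
  then show "w \<in> {c (Suc a mod g), c ((a + g - 1) mod g)}"
  proof cases
    case 1
    then show ?thesis
      using no_chord[OF 1 j(1,3)] j by auto
  next
    case 2
    then have "a = Suc j \<or> j = 0 \<and> a = g - 1"
      using no_chord[OF 2 a] j(3) arcs_sym by blast
    then show ?thesis
      using j g3 by auto
  qed
qed

text \<open>The path from \<open>c i\<close> to \<open>c j\<close>, closed through \<open>v\<close>,
  is a cycle of length \<open>j - i + 2\<close>.\<close>

lemma nbrs_off_cycle_far:
  assumes "v \<notin> C" "i < j" "j < g" "(v, c i) \<in> parcs G" "(v, c j) \<in> parcs G"
  shows "g \<le> j - i + 2"
proof -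
  define n where "n = j - i + 2"
  define d where "d k = (case k of 0 \<Rightarrow> v | Suc l \<Rightarrow> c (i + l))" for k
  have "cycle_embedding G n d"
    unfolding cycle_embedding_def
  proof (intro conjI allI impI)
    show "n \<ge> 3"
      using assms by (simp add: n_def)
    have "v \<noteq> c k" if "k < g" for k
      using assms(1) that by (auto simp: C_def)
    then have "d x \<noteq> d y" if "x < y" "y < n" for x y
      using that c_inj assms(2,3) by (cases x; cases y) (auto simp: n_def d_def)
    then show "inj_on d {..<n}"
      by (intro linorder_inj_onI) auto
    fix k assume k: "k < n"
    show "(d k, d (Suc k mod n)) \<in> parcs G"
    proof (cases "Suc k = n")
      case True
      then have "d k = c j"
        using assms(2) by (auto simp: n_def d_def)
      then show ?thesis
        using True assms(5) arcs_sym by (simp add: d_def)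
    next
      case False
      then have next_k: "Suc k mod n = Suc k"
        using k by simp
      show ?thesis
      proof (cases k)
        case 0
        then show ?thesis
          using assms(4) next_k by (simp add: d_def)
      next
        case (Suc l)
        then have "i + l < j"
          using k False by (auto simp: n_def)
        then show ?thesis
          using assms(3) arc_Suc[of "i + l"] next_k Suc by (simp add: d_def)
      qed
    qed
  qed
  then show ?thesis
    unfolding n_def by (rule minimal)
qed

text \<open>For \<open>v\<close> on the cycle this is the absence of chords. Off the cycle, three
  neighbours would have indices pairwise at least \<open>g - 2\<close> apart, so the outermost two
  differ by at least \<open>2 * (g - 2)\<close>. This exceeds \<open>g - 1\<close> when
  \<open>g \<ge> 4\<close>.\<close>

lemma card_nbrs_Int_C:
  assumes "g \<ge> 4 \<or> v \<in> C"
  shows "card (nbrs G v \<inter> C) \<le> 2"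
proof (cases "v \<in> C")
  case True
  then obtain a where a: "a < g" "v = c a"
    by (auto simp: C_def)
  have "card (nbrs G v \<inter> C) \<le> card {c (Suc a mod g), c ((a + g - 1) mod g)}"
    unfolding a(2) using nbrs_on_cycle[OF a(1)] by (intro card_mono) auto
  then show ?thesis
    by (simp add: card_insert_if split: if_splits)
next
  case False
  define I where "I = {i. i < g \<and> (v, c i) \<in> parcs G}"
  have "nbrs G v \<inter> C \<subseteq> c ` I"
    by (auto simp: I_def C_def)
  then have le: "card (nbrs G v \<inter> C) \<le> card I"
    using surj_card_le[of I] by (simp add: I_def)
  show ?thesis
  proof (rule ccontr)
    assume "\<not> ?thesis"
    then have "3 \<le> card I"
      using le by simp
    then obtain T where T: "T \<subseteq> I" "card T = 3"
      by (metis obtain_subset_with_card_n)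
    then obtain x y z where xyz: "T = {x, y, z}" "x \<noteq> y" "y \<noteq> z" "x \<noteq> z"
      by (auto simp: card_3_iff)
    have far: "g \<le> j - i + 2" if "i \<in> I" "j \<in> I" "i < j" for i j
      using nbrs_off_cycle_far[OF False] that by (auto simp: I_def)
    have sep: "i + g \<le> j + 2 \<or> j + g \<le> i + 2" if "i \<in> I" "j \<in> I" "i \<noteq> j" for i j
      using far[of i j] far[of j i] that by linarith
    have I: "x \<in> I" "y \<in> I" "z \<in> I"
      using T(1) xyz(1) by auto
    then have "x < g" "y < g" "z < g"
      by (auto simp: I_def)
    then show False
      using sep[OF I(1,2) xyz(2)] sep[OF I(2,3) xyz(3)] sep[OF I(1,3) xyz(4)] assms False
      by auto
  qed
qed

lemma triangle_free:
  assumes "g \<ge> 4" "(u, v) \<in> parcs G" "(v, w) \<in> parcs G"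
  shows "(w, u) \<notin> parcs G"
proof
  assume uw: "(w, u) \<in> parcs G"
  define d where "d = (!) [u, v, w]"
  have three: "i < 3 \<longleftrightarrow> i = 0 \<or> i = 1 \<or> i = (2::nat)" for i
    by auto
  have "u \<noteq> v" "v \<noteq> w" "w \<noteq> u"
    using assms uw no_loops' by auto
  then have "cycle_embedding G 3 d"
    using assms uw by (auto simp: cycle_embedding_def d_def three inj_on_def)
  then show False
    using minimal[of 3 d] assms(1) by simp
qed

text \<open>Without triangles the neighbours of \<open>v\<close> are pairwise nonadjacent, so their
  stars are disjoint and the degree sum is the size of the union \<open>U\<close>. At most two
  neighbours lie on the cycle, each on at most two of its edges, so \<open>U\<close> misses at least
  \<open>g - 4\<close> cycle edges.\<close>

lemma sum_nbr_degrees_girth_le: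
  assumes "g \<ge> 4"
  shows "(\<Sum>w\<in>nbrs G v. card (nbrs G w)) + g \<le> card (edges G) + 4"
proof -
  let ?N = "nbrs G v"
  define U where "U = (\<Union>w\<in>?N. star G w)"
  have finU: "finite U"
    by (simp add: U_def finite_star)
  have "star G w \<inter> star G w' = {}" if "w \<in> ?N" "w' \<in> ?N" "w \<noteq> w'" for w w'
    using triangle_free[OF assms, of v w w'] that arcs_sym
    by (intro star_Int_star_nonadjacent) auto
  then have cardU: "card U = (\<Sum>w\<in>?N. card (nbrs G w))"
    unfolding U_def by (subst card_UN_disjoint) (auto simp: finite_star card_star)
  have "U \<inter> CE \<subseteq> (\<Union>w\<in>?N \<inter> C. star G w \<inter> CE)"
    using CE_subset_C by (auto simp: U_def star_eq)
  then have "card (U \<inter> CE) \<le> card (\<Union>w\<in>?N \<inter> C. star G w \<inter> CE)"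
    using finite_CE by (intro card_mono) auto
  also have "\<dots> \<le> (\<Sum>w\<in>?N \<inter> C. card (star G w \<inter> CE))"
    by (intro card_UN_le) auto
  also have "\<dots> \<le> (\<Sum>w\<in>?N \<inter> C. 2)"
    by (intro sum_mono card_star_Int_CE)
  also have "\<dots> \<le> 4"
    using card_nbrs_Int_C[of v] assms by simp
  finally have "card (U \<inter> CE) \<le> 4" .
  moreover have "card (U \<union> CE) \<le> card (edges G)"
    using CE_subset_edges star_subset_edges by (intro card_mono finite_edges) (auto simp: U_def)
  moreover have "card U + card CE = card (U \<union> CE) + card (U \<inter> CE)"
    using finU finite_CE by (rule card_Un_Int)
  ultimately show ?thesis
    using cardU card_CE by linarith
qed

text \<open>The edges at \<open>v\<close> are disjoint from the \<open>g\<close> cycle edges.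
  Contrapositively, a vertex of larger degree lies on the cycle.\<close>

lemma degree_off_cycle:
  assumes "v \<notin> C"
  shows "card (nbrs G v) + g \<le> card (edges G)"
proof -
  have "star G v \<inter> CE = {}"
    using CE_subset_C assms by (auto simp: star_eq)
  then have "card (star G v \<union> CE) = card (nbrs G v) + g"
    using finite_star finite_CE by (simp add: card_Un_disjoint card_star card_CE)
  moreover have "card (star G v \<union> CE) \<le> card (edges G)"
    using CE_subset_edges star_subset_edges by (intro card_mono finite_edges) auto
  ultimately show ?thesis
    by simp
qed

lemma degree_on_cycle: "card (nbrs G (c 0)) \<ge> 2"
proof -
  have "(c 0, c 1) \<in> parcs G"
    using arc[of 0] g3 by simp
  moreover have "(c (g - 1), c 0) \<in> parcs G"
    using arc[of "g - 1"] g3 by simp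
  ultimately have "{c 1, c (g - 1)} \<subseteq> nbrs G (c 0)"
    using arcs_sym by auto
  moreover have "card {c 1, c (g - 1)} = 2"
    using c_inj[of 1 "g - 1"] g3 by simp
  ultimately show ?thesis
    by (metis card_mono finite_nbrs)
qed

text \<open>At most two neighbours of \<open>c 0\<close> lie on the cycle, so at least
  \<open>m - g\<close> edges lead from \<open>c 0\<close> to vertices off it, where \<open>m\<close>
  is the number of edges. Together with the \<open>g\<close> cycle edges these exhaust the edge set,
  which determines the graph.\<close>

lemma iso_pendant_cycle:
  assumes deg: "card (nbrs G (c 0)) + g \<ge> card (edges G) + 2"
    and no_iso: "\<And>v. v \<in> pverts G \<Longrightarrow> nbrs G v \<noteq> {}"
  shows "digraph_iso (with_proj G) (with_proj (pendant_cycle (card (edges G)) g))"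
proof -
  let ?m = "card (edges G)"
  define N where "N = nbrs G (c 0) - C"
  define PE where "PE = (\<lambda>w. {c 0, w}) ` N"
  have finN: "finite N"
    by (simp add: N_def)
  have c0: "c 0 \<in> C"
    using g3 by (auto simp: C_def)
  have "card PE = card N"
    unfolding PE_def by (intro card_image) (auto simp: inj_on_def doubleton_eq_iff)
  moreover have "CE \<inter> PE = {}"
    using CE_subset_C by (fastforce simp: PE_def N_def)
  ultimately have card_Un: "card (CE \<union> PE) = g + card N"
    using finite_CE finN by (subst card_Un_disjoint) (auto simp: card_CE PE_def)
  have sub: "CE \<union> PE \<subseteq> edges G"
    using CE_subset_edges by (auto simp: PE_def N_def edges_iff)
  have "card (nbrs G (c 0)) = card N + card (nbrs G (c 0) \<inter> C)"
    unfolding N_def by (subst card_Un_disjoint[symmetric]) (auto intro: arg_cong[where f = card])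
  then have "card N + g \<ge> ?m"
    using deg card_nbrs_Int_C[of "c 0"] c0 by linarith
  moreover have "card (CE \<union> PE) \<le> ?m"
    using sub finite_edges by (rule card_mono[rotated])
  ultimately have cardN: "card N + g = ?m"
    using card_Un by simp
  then have edges: "edges G = CE \<union> PE"
    using card_subset_eq[OF finite_edges sub] card_Un by simp
  have "card {g..<?m} = card N"
    using cardN by simp
  then obtain h where h: "bij_betw h {g..<?m} N"
    using finite_same_card_bij finN by blast
  define f where "f i = (if i < g then c i else h i)" for i
  let ?P = "pendant_cycle ?m g"
  have P: "pair_graph ?P"
    using pair_graph_pendant_cycle g3 cardN by simp
  have vertsP: "pverts ?P = {..<g} \<union> {g..<?m}"
    by (simp add: pendant_cycle_def cycle_graph_def)
  have fC: "f i = c i" if "i < g" for i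
    using that by (simp add: f_def)
  have fN: "f i = h i" "h i \<in> N" if "i \<in> {g..<?m}" for i
    using that h by (auto simp: f_def bij_betw_def)
  have f0: "f 0 = c 0"
    using fC g3 by simp
  have inj: "inj_on f (pverts ?P)"
    unfolding vertsP
  proof (subst inj_on_Un, intro conjI)
    show "inj_on f {..<g}"
      using c_inj by (auto simp: inj_on_def f_def)
    show "inj_on f {g..<?m}"
      using h fN(1) by (auto simp: inj_on_def bij_betw_def)
    show "f ` ({..<g} - {g..<?m}) \<inter> f ` ({g..<?m} - {..<g}) = {}"
      using fN by (force simp: fC N_def C_def)
  qed
  have arcs: "parcs G = map_prod f f ` parcs ?P"
  proof (intro equalityI subsetI)
    fix a assume a: "a \<in> parcs G"
    obtain x y where xy: "a = (x, y)"
      by (cases a)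
    have "{x, y} \<in> CE \<union> PE"
      using a xy edges edges_iff by blast
    then consider i where "i < g" "{x, y} = {c i, c (Suc i mod g)}"
      | w where "w \<in> N" "{x, y} = {c 0, w}"
      by (auto simp: CE_def cedge_def PE_def)
    then show "a \<in> map_prod f f ` parcs ?P"
    proof cases
      case 1
      have "(i, Suc i mod g) \<in> parcs ?P" "(Suc i mod g, i) \<in> parcs ?P"
        using 1(1) Suc_mod_less by (auto simp: pendant_cycle_def cycle_graph_def)
      moreover have "a = map_prod f f (i, Suc i mod g) \<or> a = map_prod f f (Suc i mod g, i)"
        using 1 Suc_mod_less by (auto simp: xy fC doubleton_eq_iff)
      ultimately show ?thesis
        by blast
    next
      case 2
      obtain j where j: "j \<in> {g..<?m}" "w = f j"
        using 2(1) h fN(1) by (metis bij_betw_def imageE)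
      have "(0, j) \<in> parcs ?P" "(j, 0) \<in> parcs ?P"
        using j by (auto simp: pendant_cycle_def)
      moreover have "a = map_prod f f (0, j) \<or> a = map_prod f f (j, 0)"
        using 2 j f0 by (auto simp: xy doubleton_eq_iff)
      ultimately show ?thesis
        by blast
    qed
  next
    fix a assume "a \<in> map_prod f f ` parcs ?P"
    then obtain i j where ij: "(i, j) \<in> parcs ?P" "a = (f i, f j)"
      by auto
    then consider "i < g" "j < g" "j = Suc i mod g" | "i < g" "j < g" "i = Suc j mod g"
      | "i = 0" "j \<in> {g..<?m}" | "j = 0" "i \<in> {g..<?m}"
      by (auto simp: pendant_cycle_def cycle_graph_def)
    then show "a \<in> parcs G"
    proof cases
      case 1
      then show ?thesis
        using arc[of i] ij(2) by (simp add: fC)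
    next
      case 2
      then show ?thesis
        using arc[of j] ij(2) arcs_sym by (simp add: fC)
    next
      case 3
      then show ?thesis
        using fN[OF 3(2)] ij(2) f0 by (simp add: N_def)
    next
      case 4
      then show ?thesis
        using fN[OF 4(2)] ij(2) f0 arcs_sym by (simp add: N_def)
    qed
  qed
  \<comment> \<open>Every vertex of \<open>G\<close> is an end of some arc, so the description of
    the arcs also determines the vertices.\<close>
  have verts: "pverts G = f ` pverts ?P"
  proof (intro equalityI subsetI)
    fix v assume "v \<in> pverts G"
    then obtain w where "(v, w) \<in> parcs G"
      using no_iso by fastforce
    then obtain i j where "(i, j) \<in> parcs ?P" "v = f i"
      unfolding arcs by auto
    then show "v \<in> f ` pverts ?P"
      using pair_wf_digraph.in_arcsD1[of ?P] P by (auto simp: pair_graph_def pair_digraph_def pair_fin_digraph_def)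
  next
    fix v assume "v \<in> f ` pverts ?P"
    then obtain i where i: "i \<in> pverts ?P" "v = f i"
      by auto
    show "v \<in> pverts G"
    proof (cases "i < g")
      case True
      then show ?thesis
        using i arc[of i] wellformed' by (auto simp: fC)
    next
      case False
      then show ?thesis
        using i fN[of i] nbrs_subset_verts[of "c 0"] by (auto simp: vertsP N_def simp del: nbrs_iff)
    qed
  qed
  have "digraph_iso (with_proj ?P) (with_proj G)"
    unfolding digraph_iso_with_proj_iff[OF P] using inj verts arcs by blast
  moreover have "wf_digraph (with_proj ?P)"
    using P unfolding wf_digraph_wp_iff by (simp add: pair_graph_def pair_digraph_def pair_fin_digraph_def)
  ultimately show ?thesis
    using digraph_iso_swap by blast
qed

end

text \<open>This is the weight condition at a vertex of degree \<open>d\<close> with neighbour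
  degree sum \<open>S\<close>. For \<open>d \<le> 2\<close> the bound \<open>S \<le> d * D\<close>
  suffices.\<close>

lemma degree_weight_arith:
  fixes d D S :: nat
  assumes "d \<le> D" "S \<le> d * D"
    and "d \<ge> 3 \<Longrightarrow> S \<le> D + 3 \<or> S + d \<le> 2 * D + 4 \<and> D \<ge> 4"
  shows "d * d + S \<le> (D + 2) * d"
proof (cases "d \<ge> 3")
  case False
  then have "d * d \<le> 2 * d"
    by (intro mult_le_mono1) simp
  moreover have "(D + 2) * d = d * D + 2 * d"
    by (simp add: algebra_simps)
  ultimately show ?thesis
    using assms(2) by linarith
next
  case True
  \<comment> \<open>With \<open>d = 3 + a\<close> and \<open>D = d + e\<close>, the room for
    \<open>S\<close> is \<open>6 + 2 * a + 3 * e + a * e\<close>. It is compared with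
    \<open>6 + a + e\<close> or \<open>7 + a + 2 * e\<close>; the latter fits once
    \<open>a + e \<ge> 1\<close>, which is \<open>D \<ge> 4\<close>.\<close>
  then obtain a where a: "d = 3 + a"
    using le_iff_add by blast
  obtain e where e: "D = d + e"
    using assms(1) le_iff_add by blast
  show ?thesis
    using assms(3)[OF True] a e by (auto simp: algebra_simps)
qed

section \<open>Upper bounds on the radius when all degrees are small\<close>

context girth_cycle
begin

lemma cycle_verts: "c 0 \<in> pverts G"
  using arc[of 0] g3 wellformed' by auto

lemma signless_radius_le_of_degree_le:
  assumes no_iso: "\<And>v. v \<in> pverts G \<Longrightarrow> nbrs G v \<noteq> {}"
    and deg: "\<And>v. v \<in> pverts G \<Longrightarrow> card (nbrs G v) + g \<le> card (edges G) + 1"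
    and not5: "\<not> (card (edges G) = 5 \<and> g = 3)"
  shows "signless_radius G \<le> real (card (edges G) - g) + 3"
proof -
  define D where "D = card (edges G) + 1 - g"
  have D: "D + g = card (edges G) + 1" "D \<ge> 2"
    using deg[OF cycle_verts] degree_on_cycle by (auto simp: D_def)
  have degD: "card (nbrs G v) \<le> D" if "v \<in> pverts G" for v
    using deg[OF that] D by linarith
  have B: "real (card (edges G) - g) + 3 = real (D + 2)"
    using D by simp
  show ?thesis
    unfolding B
  proof (rule signless_radius_le_weight_bound[where x = "\<lambda>v. real (card (nbrs G v))"])
    show "pverts G \<noteq> {}"
      using cycle_verts by auto
    show "real (card (nbrs G v)) > 0" if "v \<in> pverts G" for v
      using no_iso[OF that] by (simp add: card_gt_0_iff)
    fix v assume v: "v \<in> pverts G"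
    let ?d = "card (nbrs G v)" and ?S = "\<Sum>w\<in>nbrs G v. card (nbrs G w)"
    have "?S \<le> (\<Sum>w\<in>nbrs G v. D)"
      using degD nbrs_subset_verts by (intro sum_mono) blast
    then have "?S \<le> ?d * D"
      by simp
    \<comment> \<open>For \<open>g \<ge> 4\<close> the bound \<open>m - g + 4\<close> is
      \<open>D + 3\<close>. For \<open>g = 3\<close> one has \<open>m = D + 2\<close>, so twice the
      size is \<open>2 * D + 4\<close>; a degree of at least 3 forces \<open>D \<ge> 3\<close>, and
      \<open>D = 3\<close> is the excluded size 5.\<close>
    moreover have "?S \<le> D + 3 \<or> ?S + ?d \<le> 2 * D + 4 \<and> D \<ge> 4" if "?d \<ge> 3"
    proof (cases "g \<ge> 4")
      case True
      then show ?thesis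
        using sum_nbr_degrees_girth_le[of v] D by linarith
    next
      case False
      then have "g = 3"
        using g3 by simp
      then show ?thesis
        using sum_nbr_degrees_le[OF v] D not5 that degD[OF v] by linarith
    qed
    ultimately have "?d * ?d + ?S \<le> (D + 2) * ?d"
      using degD[OF v] by (intro degree_weight_arith) auto
    then have "real (?d * ?d + ?S) \<le> real ((D + 2) * ?d)"
      by (simp only: of_nat_le_iff)
    then show "real ?d * real ?d + (\<Sum>w\<in>nbrs G v. real (card (nbrs G w))) \<le> real (D + 2) * real ?d"
      by (simp add: distrib_right)
  qed
qed

text \<open>For \<open>K\<^sub>4\<close> minus an edge the degree weights only give \<open>16 / 3\<close>, which exceeds
  the radius of the extremal graph; the weights below approximate its Perron vector.\<close>

lemma signless_radius_le_size_5:
  assumes no_iso: "\<And>v. v \<in> pverts G \<Longrightarrow> nbrs G v \<noteq> {}"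
    and deg: "\<And>v. v \<in> pverts G \<Longrightarrow> card (nbrs G v) \<le> 3"
    and size: "card (edges G) = 5"
  shows "signless_radius G \<le> 21 / 4"
proof -
  \<comment> \<open>For K4 minus an edge the ratio of the two Perron entries is the golden ratio,
    which 8 / 5 approximates.\<close>
  define x :: "'a \<Rightarrow> real" where "x v = (if card (nbrs G v) = 3 then 8 / 5 else 1)" for v
  have x_le: "x v \<le> 8 / 5" for v
    by (simp add: x_def)
  \<comment> \<open>Three stars of size 3 that pairwise share at most one edge cover at least 6
    edges. Hence a vertex of degree 3 has at most one neighbour of degree 3.\<close>
  have no3: False if "a \<in> nbrs G v" "b \<in> nbrs G v" "a \<noteq> b"
    "card (nbrs G v) = 3" "card (nbrs G a) = 3" "card (nbrs G b) = 3" for v a b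
  proof -
    have ne: "v \<noteq> a" "v \<noteq> b"
      using that no_loops' by auto
    have 1: "card (star G v) + card (star G a) = card (star G v \<union> star G a) + card (star G v \<inter> star G a)"
      by (intro card_Un_Int finite_star)
    have 2: "card (star G v \<union> star G a) + card (star G b)
      = card (star G v \<union> star G a \<union> star G b) + card ((star G v \<union> star G a) \<inter> star G b)"
      by (intro card_Un_Int finite_UnI finite_star)
    have "(star G v \<union> star G a) \<inter> star G b = (star G v \<inter> star G b) \<union> (star G a \<inter> star G b)"
      by blast
    then have "card ((star G v \<union> star G a) \<inter> star G b)
      \<le> card (star G v \<inter> star G b) + card (star G a \<inter> star G b)"
      by (simp add: card_Un_le)
    moreover have "card (star G v \<union> star G a \<union> star G b) \<le> card (edges G)"
      using star_subset_edges by (intro card_mono finite_edges) blast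
    ultimately show False
      using 1 2 card_star_Int_star[OF ne(1)] card_star_Int_star[OF ne(2)]
        card_star_Int_star[OF that(3)] that(4-6) size
      unfolding card_star by linarith
  qed
  show ?thesis
  proof (rule signless_radius_le_weight_bound[where x = x])
    show "pverts G \<noteq> {}"
      using cycle_verts by auto
    show "x v > 0" for v
      by (simp add: x_def)
    fix v assume v: "v \<in> pverts G"
    let ?N = "nbrs G v"
    show "real (card ?N) * x v + sum x ?N \<le> 21 / 4 * x v"
    proof (cases "card ?N = 3")
      case True
      have "finite {w \<in> ?N. card (nbrs G w) = 3}"
        by (rule finite_subset[of _ ?N]) auto
      then have "card {w \<in> ?N. card (nbrs G w) = 3} \<le> 1"
        using no3[of _ v] True by (auto simp: card_le_Suc0_iff_eq)
      moreover have "sum x ?N = (\<Sum>w\<in>?N. 1 + (if card (nbrs G w) = 3 then 3 / 5 else 0))"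
        by (intro sum.cong) (auto simp: x_def)
      then have "sum x ?N = 3 + 3 / 5 * real (card {w \<in> ?N. card (nbrs G w) = 3})"
        using True by (simp add: sum.distrib sum.If_cases Int_def)
      \<comment> \<open>The worst case is an equality: \<open>3 * (8 / 5) + 3 + 3 / 5\<close> equals
        \<open>21 / 4 * (8 / 5)\<close>.\<close>
      ultimately show ?thesis
        using True by (simp add: x_def)
    next
      case False
      then have d: "card ?N \<le> 2"
        using deg[OF v] by simp
      \<comment> \<open>With at most two neighbours the total is at most \<open>2 + 16 / 5\<close>,
        just below 21 / 4.\<close>
      have "sum x ?N \<le> (\<Sum>w\<in>?N. 8 / 5)"
        by (intro sum_mono x_le)
      also have "\<dots> = 8 / 5 * real (card ?N)"
        by simp
      finally show ?thesis
        using d False by (simp add: x_def)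
    qed
  qed
qed

end

theorem theorem1p1:
  fixes m g :: nat and G :: "'a pair_pre_digraph"
  assumes "g \<ge> 3" and "G \<in> graphs_size_girth m g"
  shows "signless_radius G \<le> signless_radius (pendant_cycle m g) \<and>
    (signless_radius G = signless_radius (pendant_cycle m g) \<longleftrightarrow>
      digraph_iso (with_proj G) (with_proj (pendant_cycle m g)))"
proof -
  have G: "pair_graph G" and size: "card (edges G) = m" and girth: "girth G = enat g"
    using assms(2) by (auto simp: graphs_size_girth_def)
  interpret pair_graph G by fact
  have no_iso: "nbrs G v \<noteq> {}" if "v \<in> pverts G" for v
    using assms(2) that by (auto simp: graphs_size_girth_def no_isolated_def out_degree_eq_card_nbrs)
  obtain c where c: "cycle_embedding G g c"
    using girth_attained[OF girth] .
  have minimal: "g \<le> n" if "cycle_embedding G n d" for n d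
    using girth_le_of_cycle_embedding[OF that] girth by simp
  interpret girth_cycle G g c
    by unfold_locales (use c minimal in auto)
  have mg: "g \<le> m"
    using card_mono[OF finite_edges CE_subset_edges] card_CE size by simp
  \<comment> \<open>This dichotomy, together with invariance of the radius under isomorphism, yields
    both the inequality and the equality case.\<close>
  have "digraph_iso (with_proj G) (with_proj (pendant_cycle m g)) \<or>
    signless_radius G < signless_radius (pendant_cycle m g)"
  proof (cases "\<exists>v \<in> pverts G. card (nbrs G v) + g \<ge> m + 2")
    case True
    then obtain v where v: "v \<in> pverts G" "card (nbrs G v) + g \<ge> m + 2"
      by blast
    then have "v \<in> C"
      using degree_off_cycle[of v] size by linarith
    then obtain a where a: "a < g" "v = c a"
      by (auto simp: C_def)
    \<comment> \<open>Rotation by \<open>a\<close> puts the vertex of large degree at index 0, as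
      \<open>iso_pendant_cycle\<close> expects.\<close>
    interpret rotated: girth_cycle G g "\<lambda>i. c ((i + a) mod g)"
      by unfold_locales (use cycle_embedding_rotate[OF c] minimal in auto)
    show ?thesis
      using rotated.iso_pendant_cycle v a size no_iso by simp
  next
    case False
    then have deg: "card (nbrs G v) + g \<le> m + 1" if "v \<in> pverts G" for v
      using that by fastforce
    \<comment> \<open>A vertex of the cycle has degree at least 2, which the degree bound
      \<open>m - g + 1\<close> permits only if \<open>g < m\<close>. The bare cycle, with
      \<open>m = g\<close>, falls under the previous case.\<close>
    then have gm: "g < m"
      using deg[OF cycle_verts] degree_on_cycle by linarith
    show ?thesis
    proof (cases "m = 5 \<and> g = 3")
      case True
      then have "signless_radius G \<le> 21 / 4"
        using signless_radius_le_size_5 no_iso deg size by fastforce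
      then show ?thesis
        using pendant_cycle_signless_radius_gt(2)[OF assms(1) gm] True by simp
    next
      case False
      then have "signless_radius G \<le> real (m - g) + 3"
        using signless_radius_le_of_degree_le no_iso deg size by simp
      then show ?thesis
        using pendant_cycle_signless_radius_gt(1)[OF assms(1) gm] by simp
    qed
  qed
  moreover have "signless_radius G = signless_radius (pendant_cycle m g)"
    if "digraph_iso (with_proj G) (with_proj (pendant_cycle m g))"
    using digraph_iso_signless_radius[OF G pair_graph_pendant_cycle[OF assms(1) mg] that] .
  ultimately show ?thesis
    by auto
qed

end
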